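(* Let $p_0,p_1,p_2,p_3,p_4\ge 0$ with $p_0+p_1+p_2+p_3+p_4=1$. Let $P$ be the $N^2\times N^2$ transition matrix of the random walk on the $N\times N$ torus $(\mathbb{Z}/N\mathbb{Z})^2$ which at each step, from $(x,y)$, stays at $(x,y)$ with probability $p_0$ and moves to $(x+1,y)$, $(x-1,y)$, $(x,y+1)$, $(x,y-1)$ with probabilities $p_1,p_2,p_3,p_4$ respectively. Let $L=I-PP^T$, with eigenvalues $\lambda_i$, $0\le i\le N^2-1$, listed with multiplicity. If two walkers perform independent random walks with transition matrix $P$, with initial positions independent and uniformly distributed on the torus, and $\tau$ is their meeting time, then $$\mathbf{E}[\tau]=\sum_{i:\,\lambda_i\neq 0}\lambda_i^{-1}.$$
   Context: Time is discrete and in each time slot both walkers move simultaneously and independently, each according to $P$, where $P(u,v)$ is the probability that a walker at vertex $u$ moves to vertex $v$. The meeting time $\tau$ is the first time $t\ge 0$ at which the two walkers are at the same vertex (so $\tau=0$ if they start at the same vertex). $I$ is the $N^2\times N^2$ identity matrix and $P^T$ is the transpose of $P$.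
   Formalization: The formal theorem additionally assumes that the two walkers meet almost surely; without this the claim fails (e.g. p_0=1, N=2: L=0 so the sum is 0, but E[τ]=∞), and the excluded cases are exactly those where E[τ]=∞ while the sum is finite. *)

theory Defs
  imports
    "HOL-Probability.Probability"
    "Jordan_Normal_Form.Char_Poly"
begin

text \<open>The residues modulo \<open>N\<close> are represented by the integers \<open>0, \<dots>, N - 1\<close>.\<close>

definition torus :: "nat \<Rightarrow> (int \<times> int) set" where
  "torus N = {0..<int N} \<times> {0..<int N}"

text \<open>The contributions are added up, so that coinciding targets are treated correctly
  (for instance \<open>x + 1 = x - 1\<close> when \<open>N = 2\<close>).\<close>

definition torus_step :: "nat \<Rightarrow> (nat \<Rightarrow> real) \<Rightarrow> int \<times> int \<Rightarrow> int \<times> int \<Rightarrow> real" where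
  "torus_step N p u v = (case u of (x, y) \<Rightarrow>
       p 0 * of_bool (v = (x, y))
     + p 1 * of_bool (v = ((x + 1) mod int N, y))
     + p 2 * of_bool (v = ((x - 1) mod int N, y))
     + p 3 * of_bool (v = (x, (y + 1) mod int N))
     + p 4 * of_bool (v = (x, (y - 1) mod int N)))"

text \<open>Rows and columns are numbered by \<open>k < N\<^sup>2\<close>, through this bijection onto the torus.\<close>

definition torus_vertex :: "nat \<Rightarrow> nat \<Rightarrow> int \<times> int" where
  "torus_vertex N k = (int (k div N), int (k mod N))"

definition transition_mat :: "nat \<Rightarrow> (nat \<Rightarrow> real) \<Rightarrow> real mat" where
  "transition_mat N p = mat (N\<^sup>2) (N\<^sup>2)
     (\<lambda>(i, j). torus_step N p (torus_vertex N i) (torus_vertex N j))"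

definition meeting_laplacian :: "nat \<Rightarrow> (nat \<Rightarrow> real) \<Rightarrow> real mat" where
  "meeting_laplacian N p =
     1\<^sub>m (N\<^sup>2) - transition_mat N p * transpose_mat (transition_mat N p)"

text \<open>\<open>X\<close> is a Markov chain on \<open>S\<close> with transition probabilities \<open>K\<close>; the initial
  distribution is left open.\<close>

definition markov_chain ::
    "'w measure \<Rightarrow> 's set \<Rightarrow> ('s \<Rightarrow> 's \<Rightarrow> real) \<Rightarrow> (nat \<Rightarrow> 'w \<Rightarrow> 's) \<Rightarrow> bool" where
  "markov_chain M S K X \<longleftrightarrow>
     (\<forall>t. X t \<in> measurable M (count_space S)) \<and>
     (\<forall>t u. \<forall>v\<in>S. \<P>(\<omega> in M. \<forall>s\<le>t. X s \<omega> = u s) > 0 \<longrightarrow>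
        \<P>(\<omega> in M. X (Suc t) \<omega> = v \<bar> \<forall>s\<le>t. X s \<omega> = u s) = K (u t) v)"

text \<open>The value is \<open>\<infinity>\<close> if the walkers never meet, the infimum of the empty set in \<^typ>\<open>enat\<close>.\<close>

definition meeting_time :: "(nat \<Rightarrow> 'w \<Rightarrow> 's) \<Rightarrow> (nat \<Rightarrow> 'w \<Rightarrow> 's) \<Rightarrow> 'w \<Rightarrow> enat" where
  "meeting_time X Y \<omega> = (INF t \<in> {t. X t \<omega> = Y t \<omega>}. enat t)"

end

theory Submission
  imports Defs
begin

text \<open>Let \<open>n = N\<^sup>2\<close>, let \<open>J\<close> be the all-ones matrix, and let \<open>U(x, y)\<close> be the expected number of times at
  which the walkers are at \<open>x\<close> and \<open>y\<close> without having met so far, so that the entries of \<open>U\<close>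
  add up to \<open>E[\<tau>]\<close>. The first-step equation reads \<open>U = J / n\<^sup>2 + P\<^sup>T U P\<close> off the diagonal, where \<open>U\<close>
  vanishes on the diagonal. All matrices involved are translation invariant and hence commute, so
  \<open>L U\<close> equals \<open>J / n\<^sup>2\<close> off the diagonal, and \<open>J L = 0\<close> forces \<open>L U = J / n\<^sup>2 - I / n\<close>. Consequently
  \<open>L + J\<close> has an inverse of the form \<open>c J - n U\<close>, with trace \<open>c n = 1 / n + E[\<tau>]\<close>. On the other hand
  the eigenvalues of \<open>L + J\<close> are those of \<open>L\<close> with one eigenvalue \<open>0\<close> replaced by \<open>n\<close>, and the trace of the
  inverse is the sum of their reciprocals, read off as a logarithmic derivative of the characteristic
  polynomial at \<open>0\<close>. That \<open>U\<close> is finite follows from the almost sure finiteness of \<open>\<tau>\<close>.\<close>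

section \<open>The trace of the inverse and the characteristic polynomial\<close>

text \<open>The derivative of a characteristic polynomial is the sum of those of the principal
  submatrices with one row and column deleted. At \<open>0\<close> these are the diagonal entries of
  the adjugate of \<open>- A\<close>, which is \<open>det (- A)\<close> times the inverse
  \<open>- G\<close>.\<close>

lemma poly_pderiv_char_poly_0:
  fixes A G :: "'a :: field mat"
  assumes A: "A \<in> carrier_mat n n" and G: "G \<in> carrier_mat n n" and AG: "A * G = 1\<^sub>m n"
  shows "poly (pderiv (char_poly A)) 0 = - (poly (char_poly A) 0 * (\<Sum>i<n. G $$ (i, i)))"
proof -
  have B: "- A \<in> carrier_mat n n" and mG: "- G \<in> carrier_mat n n"
    using A G by auto
  have p0: "poly (char_poly C) 0 = det (- C)" if "C \<in> carrier_mat m m" for C :: "'a mat" and m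
  proof -
    have "- char_matrix C 0 = - C"
      using that by (intro eq_matI) (auto simp: char_matrix_def)
    then show ?thesis
      using char_poly_matrix[OF that, of 0] by simp
  qed
  have inv: "(- A) * (- G) = 1\<^sub>m n"
    using AG A G by simp
  have adj: "adj_mat (- A) = det (- A) \<cdot>\<^sub>m (- G)"
  proof -
    have "adj_mat (- A) = adj_mat (- A) * ((- A) * (- G))"
      unfolding inv using adj_mat(1)[OF B] by simp
    also have "\<dots> = (adj_mat (- A) * (- A)) * (- G)"
      using assoc_mult_mat[OF adj_mat(1)[OF B] B mG] by simp
    also have "\<dots> = det (- A) \<cdot>\<^sub>m (- G)"
      unfolding adj_mat(3)[OF B] using mG by (subst mult_smult_assoc_mat[of _ n n _ n]) auto
    finally show ?thesis .
  qed
  have minor: "poly (char_poly (mat_delete A i i)) 0 = - (det (- A) * G $$ (i, i))" if "i < n" for i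
  proof -
    have "poly (char_poly (mat_delete A i i)) 0 = det (- mat_delete A i i)"
      using A by (intro p0[of _ "n - 1"]) auto
    also have "- mat_delete A i i = mat_delete (- A) i i"
      using A that by (intro eq_matI) (auto simp: mat_delete_def)
    also have "det (mat_delete (- A) i i) = adj_mat (- A) $$ (i, i)"
      using A that by (simp add: adj_mat_def cofactor_def)
    also have "\<dots> = - (det (- A) * G $$ (i, i))"
      unfolding adj using G that by simp
    finally show ?thesis .
  qed
  show ?thesis
    unfolding pderiv_char_poly[OF A] poly_sum p0[OF A]
    by (simp add: minor sum_negf sum_distrib_left)
qed

section \<open>The all-ones matrix and the spectrum of \<open>L + J\<close>\<close>

definition ones_mat :: "nat \<Rightarrow> 'a :: one mat" where
  "ones_mat n = mat n n (\<lambda>_. 1)"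

lemma ones_mat_carrier [simp]: "ones_mat n \<in> carrier_mat n n"
  by (simp add: ones_mat_def)

lemma dim_ones_mat [simp]: "dim_row (ones_mat n) = n" "dim_col (ones_mat n) = n"
  by (simp_all add: ones_mat_def)

lemma index_ones_mat [simp]: "i < n \<Longrightarrow> j < n \<Longrightarrow> ones_mat n $$ (i, j) = 1"
  by (simp add: ones_mat_def)

lemma char_poly_ones_mat:
  assumes "n \<ge> 1"
  shows "char_poly (ones_mat n :: 'a :: comm_ring_1 mat) = [:- of_nat n, 1:] * [:0, 1:] ^ (n - 1)"
proof -
  \<comment> \<open>The first column of \<open>T\<close> is the eigenvector of the all-ones matrix for the eigenvalue \<open>n\<close>.\<close>
  define T :: "'a mat" where
    "T = mat n n (\<lambda>(i, j). if j = 0 then 1 else if i = j then 1 else 0)"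
  define T' :: "'a mat" where
    "T' = mat n n (\<lambda>(i, j). if i = j then 1 else if j = 0 then - 1 else 0)"
  \<comment> \<open>\<open>U\<close> is the all-ones matrix in the basis given by the columns of
    \<open>T\<close>: the all-ones vector goes to \<open>n\<close> times itself, and every other
    basis vector, being a unit vector, goes to the all-ones vector.\<close>
  define U :: "'a mat" where "U = mat n n (\<lambda>(i, j). if i = 0 then if j = 0 then of_nat n else 1 else 0)"
  have carr [simp]: "T \<in> carrier_mat n n" "T' \<in> carrier_mat n n" "U \<in> carrier_mat n n"
    by (simp_all add: T_def T'_def U_def)
  have split0: "(\<Sum>k = 0..<n. f k) = f 0 + (\<Sum>k = 1..<n. f k)" for f :: "nat \<Rightarrow> 'a"
    using assms by (simp add: sum.atLeast_Suc_lessThan)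
  have TT': "T * T' = 1\<^sub>m n"
    by (intro eq_matI)
      (auto simp: T_def T'_def scalar_prod_def split0 if_distrib[where f="\<lambda>x. x * _"] cong: sum.cong_simp if_cong)
  have T'T: "T' * T = 1\<^sub>m n"
    by (intro eq_matI)
      (auto simp: T_def T'_def scalar_prod_def split0 if_distrib[where f="\<lambda>x. x * _"] cong: sum.cong_simp if_cong)
  have UT': "U * T' = mat n n (\<lambda>(i, j). if i = 0 then 1 else 0)"
    using assms
    by (intro eq_matI)
      (auto simp: U_def T'_def scalar_prod_def split0 of_nat_diff cong: sum.cong_simp)
  have "T * U * T' = T * (U * T')"
    by (rule assoc_mult_mat[of _ n n _ n _ n]) simp_all
  also have "\<dots> = ones_mat n"
    unfolding UT'
    by (intro eq_matI) (auto simp: T_def scalar_prod_def split0)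
  finally have "similar_mat_wit (ones_mat n) U T T'"
    using TT' T'T by (auto simp: similar_mat_wit_def Let_def)
  then have "char_poly (ones_mat n :: 'a mat) = char_poly U"
    by (intro char_poly_similar) (auto simp: similar_mat_def)
  also have "\<dots> = (\<Prod>a\<leftarrow>diag_mat U. [:- a, 1:])"
    by (rule char_poly_upper_triangular[of _ n]) (auto simp: U_def)
  also have "diag_mat U = of_nat n # replicate (n - 1) 0"
    using assms
    by (intro nth_equalityI) (auto simp: diag_mat_def U_def nth_Cons')
  finally show ?thesis
    by (simp add: prod_list_replicate map_replicate)
qed

text \<open>Adding \<open>J\<close> trades one eigenvalue \<open>0\<close> of \<open>L\<close> for
  \<open>n\<close>. The multiplicative form avoids dividing by the linear factor that belongs to the
  eigenvalue \<open>0\<close>.\<close>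

lemma char_poly_add_ones_mat:
  fixes L :: "real mat"
  assumes n: "n \<ge> 1" and L: "L \<in> carrier_mat n n" and LJ: "L * ones_mat n = 0\<^sub>m n n"
  shows "[:0, 1:] * char_poly (L + ones_mat n) = [:- real n, 1:] * char_poly L"
proof -
  let ?J = "ones_mat n :: real mat"
  have cm: "- char_matrix C t = t \<cdot>\<^sub>m 1\<^sub>m n - C" if "C \<in> carrier_mat n n" for C :: "real mat" and t
    using that by (intro eq_matI) (auto simp: char_matrix_def)
  \<comment> \<open>\<open>(t I - L) (t I - J) = t (t I - (L + J))\<close> because \<open>L J = 0\<close>.\<close>
  have *: "poly (char_poly L) t * poly (char_poly ?J) t = t ^ n * poly (char_poly (L + ?J)) t" for t
  proof -
    have "(t \<cdot>\<^sub>m 1\<^sub>m n - L) * (t \<cdot>\<^sub>m 1\<^sub>m n - ?J) = t \<cdot>\<^sub>m 1\<^sub>m n * (t \<cdot>\<^sub>m 1\<^sub>m n - ?J) - L * (t \<cdot>\<^sub>m 1\<^sub>m n - ?J)"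
      using L by (intro minus_mult_distrib_mat[of _ n n _ _ n]) auto
    also have "t \<cdot>\<^sub>m 1\<^sub>m n * (t \<cdot>\<^sub>m 1\<^sub>m n - ?J) = t \<cdot>\<^sub>m (t \<cdot>\<^sub>m 1\<^sub>m n - ?J)"
      by (subst mult_smult_assoc_mat[of _ n n _ n]) auto
    also have "L * (t \<cdot>\<^sub>m 1\<^sub>m n - ?J) = t \<cdot>\<^sub>m L"
      using L LJ by (simp add: mult_minus_distrib_mat[of _ n n _ n] mult_smult_distrib[of _ n n _ n])
        (intro eq_matI, auto)
    also have "t \<cdot>\<^sub>m (t \<cdot>\<^sub>m 1\<^sub>m n - ?J) - t \<cdot>\<^sub>m L = t \<cdot>\<^sub>m (t \<cdot>\<^sub>m 1\<^sub>m n - (L + ?J))"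
      using L by (intro eq_matI) (auto simp: algebra_simps)
    finally have "det (t \<cdot>\<^sub>m 1\<^sub>m n - L) * det (t \<cdot>\<^sub>m 1\<^sub>m n - ?J) = det (t \<cdot>\<^sub>m (t \<cdot>\<^sub>m 1\<^sub>m n - (L + ?J)))"
      using L by (subst det_mult[of _ n, symmetric]) auto
    then show ?thesis
      using L by (simp add: char_poly_matrix[of _ n] cm)
  qed
  have "[:0, 1:] ^ (n - 1) * ([:- real n, 1:] * char_poly L) = char_poly L * char_poly ?J"
    unfolding char_poly_ones_mat[OF n] by (simp only: mult_ac)
  \<comment> \<open>Real polynomials with equal values everywhere are equal, so the pointwise
    determinant identity lifts; the power \<open>n - 1\<close> that comes from \<open>J\<close> is
    cancelled at the end.\<close>
  also have "\<dots> = [:0, 1:] ^ n * char_poly (L + ?J)"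
    using * by (intro poly_eq_poly_eq_iff[THEN iffD1] ext) simp
  also have "\<dots> = [:0, 1:] ^ (n - 1) * ([:0, 1:] * char_poly (L + ?J))"
    using n by (cases n) (simp_all add: mult_ac del: mult_pCons_left)
  finally show ?thesis
    by (metis mult_cancel_left pCons_eq_0_iff one_neq_zero power_eq_0_iff)
qed

text \<open>The logarithmic derivative of the characteristic polynomial of \<open>L + J\<close> at
  \<open>0\<close> is computed twice: from the trace of the inverse and from the linear factors. The
  root \<open>n\<close> contributes \<open>1 / n\<close>, which matches the \<open>1 / n\<close> in
  the trace.\<close>

lemma sum_inverse_eigenvalues:
  fixes L U :: "real mat" and lam :: "nat \<Rightarrow> real"
  assumes n: "n \<ge> 1"
    and L: "L \<in> carrier_mat n n" and U: "U \<in> carrier_mat n n"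
    and LJ: "L * ones_mat n = 0\<^sub>m n n"
    and eigenvalues: "char_poly L = (\<Prod>i<n. [:- lam i, 1:])"
    and diag: "\<And>i. i < n \<Longrightarrow> U $$ (i, i) = 0"
    and colsum: "ones_mat n * U = s \<cdot>\<^sub>m ones_mat n"
    and LU: "L * U = (1 / real n ^ 2) \<cdot>\<^sub>m ones_mat n - (1 / real n) \<cdot>\<^sub>m 1\<^sub>m n"
  shows "(\<Sum>i | i < n \<and> lam i \<noteq> 0. inverse (lam i)) = real n * s"
proof -
  let ?J = "ones_mat n :: real mat"
  let ?A = "L + ?J"
  \<comment> \<open>The value of \<open>c\<close> makes the multiples of \<open>J\<close> in
    \<open>?A * G\<close> cancel: \<open>n * c = 1 / n + n * s\<close>.\<close>
  define c where "c = 1 / real n ^ 2 + s"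
  define G where "G = c \<cdot>\<^sub>m ?J - real n \<cdot>\<^sub>m U"
  have G: "G \<in> carrier_mat n n"
    using U by (simp add: G_def minus_carrier_mat)
  have A: "?A \<in> carrier_mat n n"
    using L by simp
  have JJ: "?J * ?J = real n \<cdot>\<^sub>m ?J"
    by (intro eq_matI) (auto simp: scalar_prod_def)
  have "?A * G = c \<cdot>\<^sub>m (?A * ?J) - real n \<cdot>\<^sub>m (?A * U)"
    using L U A by (simp add: G_def mult_minus_distrib_mat[of _ n n _ n] mult_smult_distrib[of _ n n _ n])
  also have "?A * ?J = real n \<cdot>\<^sub>m ?J"
    using L by (simp add: add_mult_distrib_mat[of _ n n _ _ n] LJ JJ)
  also have "?A * U = L * U + s \<cdot>\<^sub>m ?J"
    using L U by (simp add: add_mult_distrib_mat[of _ n n _ _ n] colsum)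
  also have "c \<cdot>\<^sub>m (real n \<cdot>\<^sub>m ?J) - real n \<cdot>\<^sub>m (L * U + s \<cdot>\<^sub>m ?J) = 1\<^sub>m n"
    unfolding LU using n by (intro eq_matI) (auto simp: c_def field_simps power2_eq_square)
  finally have AG: "?A * G = 1\<^sub>m n" .
  have trace: "(\<Sum>i<n. G $$ (i, i)) = 1 / real n + real n * s"
    using n U by (simp add: G_def diag c_def field_simps power2_eq_square)
  have pA0: "poly (char_poly ?A) 0 \<noteq> 0"
  proof
    assume "poly (char_poly ?A) 0 = 0"
    then obtain v where v: "v \<in> carrier_vec n" "v \<noteq> 0\<^sub>v n" "?A *\<^sub>v v = 0 \<cdot>\<^sub>v v"
      using A unfolding eigenvalue_root_char_poly[OF A, symmetric] eigenvalue_def eigenvector_def by auto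
    have "G * ?A = 1\<^sub>m n"
      using mat_mult_left_right_inverse[OF A G AG] .
    then have "v = G *\<^sub>v (?A *\<^sub>v v)"
      using assoc_mult_mat_vec[OF G A v(1)] v(1) by simp
    also have "\<dots> = 0\<^sub>v n"
      unfolding v(3) using G v(1) by (intro eq_vecI) auto
    finally show False
      using v(2) by simp
  qed
  note xA = char_poly_add_ones_mat[OF n L LJ]
  \<comment> \<open>At \<open>0\<close> the left side of \<open>xA\<close> vanishes, while the
    factor \<open>- n\<close> on the right does not.\<close>
  have "poly (char_poly L) 0 = 0"
    using arg_cong[OF xA, of "\<lambda>q. poly q 0"] n by simp
  then obtain k where k: "k < n" "lam k = 0"
    by (auto simp: eigenvalues poly_prod)
  define q where "q = (\<Prod>i\<in>{..<n} - {k}. [:- lam i, 1:])"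
  have "char_poly L = [:0, 1:] * q"
    using k by (simp add: eigenvalues q_def prod.remove[of "{..<n}" k])
  then have pA: "char_poly ?A = [:- real n, 1:] * q"
    using xA by (metis mult.left_commute mult_cancel_left pCons_eq_0_iff one_neq_zero)
  \<comment> \<open>Another zero among the \<open>lam i\<close> would be a root of \<open>q\<close>,
    against the invertibility of \<open>L + J\<close>; so the eigenvalue \<open>0\<close> of
    \<open>L\<close> is simple.\<close>
  have lam: "lam i \<noteq> 0" if "i < n" "i \<noteq> k" for i
    using pA0 that by (auto simp: pA q_def poly_prod)
  have dq: "poly (pderiv q) 0 = - (poly q 0 * (\<Sum>i\<in>{..<n} - {k}. inverse (lam i)))"
  proof -
    have "poly (pderiv q) 0 = (\<Sum>i\<in>{..<n} - {k}. \<Prod>j\<in>{..<n} - {k} - {i}. - lam j)"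
      by (simp add: q_def pderiv_prod poly_sum poly_prod pderiv_pCons)
    also have "\<dots> = (\<Sum>i\<in>{..<n} - {k}. - (poly q 0 * inverse (lam i)))"
    proof (rule sum.cong[OF refl])
      fix i assume i: "i \<in> {..<n} - {k}"
      then have "poly q 0 = - lam i * (\<Prod>j\<in>{..<n} - {k} - {i}. - lam j)"
        by (simp add: q_def poly_prod prod.remove[of _ i])
      then show "(\<Prod>j\<in>{..<n} - {k} - {i}. - lam j) = - (poly q 0 * inverse (lam i))"
        using lam i by (simp add: field_simps)
    qed
    finally show ?thesis
      by (simp add: sum_negf sum_distrib_left)
  qed
  have q0: "poly q 0 \<noteq> 0"
    using pA0 by (simp add: pA)
  have "poly (pderiv (char_poly ?A)) 0 = real n * poly q 0 * (1 / real n + real n * s)"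
    unfolding poly_pderiv_char_poly_0[OF A G AG] trace by (simp add: pA)
  moreover have "poly (pderiv (char_poly ?A)) 0
      = poly q 0 + real n * poly q 0 * (\<Sum>i\<in>{..<n} - {k}. inverse (lam i))"
    unfolding pA pderiv_mult by (simp add: pderiv_pCons dq)
  ultimately have "real n * s = (\<Sum>i\<in>{..<n} - {k}. inverse (lam i))"
    using q0 n by (simp add: field_simps)
  also have "{..<n} - {k} = {i. i < n \<and> lam i \<noteq> 0}"
    using lam k by auto
  finally show ?thesis by simp
qed

section \<open>Translation-invariant kernels on the torus\<close>

lemma finite_torus [simp]: "finite (torus N)"
  by (simp add: torus_def)

lemma card_torus: "card (torus N) = N\<^sup>2"
  by (simp add: torus_def power2_eq_square)

text \<open>The quotient map from integer pairs onto the torus; group operations are done on integer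
  pairs and wrapped once at the end.\<close>

definition wrap :: "nat \<Rightarrow> int \<times> int \<Rightarrow> int \<times> int" where
  "wrap N a = (fst a mod int N, snd a mod int N)"

lemma wrap_in_torus [simp]: "N \<ge> 1 \<Longrightarrow> wrap N a \<in> torus N"
  by (simp add: wrap_def torus_def)

lemma wrap_torus: "x \<in> torus N \<Longrightarrow> wrap N x = x"
  by (auto simp: wrap_def torus_def)

lemma wrap_add_left [simp]: "wrap N (wrap N a + b) = wrap N (a + b)"
  by (simp add: wrap_def mod_add_left_eq)

lemma wrap_diff_left [simp]: "wrap N (wrap N a - b) = wrap N (a - b)"
  by (simp add: wrap_def mod_diff_left_eq)

lemma wrap_diff_right [simp]: "wrap N (a - wrap N b) = wrap N (a - b)"
  by (simp add: wrap_def mod_diff_right_eq)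

lemma bij_betw_torus_translate:
  assumes "N \<ge> 1"
  shows "bij_betw (\<lambda>v. wrap N (v + a)) (torus N) (torus N)"
  using assms
  by (intro bij_betwI[where g = "\<lambda>v. wrap N (v - a)"]) (auto simp: wrap_torus)

lemma bij_betw_torus_reflect:
  assumes "N \<ge> 1"
  shows "bij_betw (\<lambda>v. wrap N (a - v)) (torus N) (torus N)"
  using assms
  by (intro bij_betwI[where g = "\<lambda>v. wrap N (a - v)"]) (auto simp: wrap_torus)

type_synonym kernel = "int \<times> int \<Rightarrow> int \<times> int \<Rightarrow> real"

definition translation_invariant :: "nat \<Rightarrow> kernel \<Rightarrow> bool" where
  "translation_invariant N f \<longleftrightarrow>
     (\<forall>a. \<forall>x\<in>torus N. \<forall>y\<in>torus N. f (wrap N (x + a)) (wrap N (y + a)) = f x y)"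

lemma translation_invariantD:
  "translation_invariant N f \<Longrightarrow> x \<in> torus N \<Longrightarrow> y \<in> torus N \<Longrightarrow>
    f (wrap N (x + a)) (wrap N (y + a)) = f x y"
  unfolding translation_invariant_def by blast

text \<open>The matrix product with vertices in place of numbers as indices, which keeps the group
  structure visible.\<close>

definition kernel_comp :: "nat \<Rightarrow> kernel \<Rightarrow> kernel \<Rightarrow> kernel" where
  "kernel_comp N f g x y = (\<Sum>v\<in>torus N. f x v * g v y)"

lemma kernel_comp_cong:
  "(\<And>v. v \<in> torus N \<Longrightarrow> f x v = f' x v) \<Longrightarrow> (\<And>v. v \<in> torus N \<Longrightarrow> g v y = g' v y) \<Longrightarrow>
    kernel_comp N f g x y = kernel_comp N f' g' x y"
  by (simp add: kernel_comp_def)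

lemma kernel_comp_assoc:
  "kernel_comp N f (kernel_comp N g h) x y = kernel_comp N (kernel_comp N f g) h x y"
proof -
  have "kernel_comp N f (kernel_comp N g h) x y = (\<Sum>v\<in>torus N. \<Sum>w\<in>torus N. f x v * (g v w * h w y))"
    by (simp add: kernel_comp_def sum_distrib_left)
  also have "\<dots> = (\<Sum>w\<in>torus N. \<Sum>v\<in>torus N. f x v * (g v w * h w y))"
    by (rule sum.swap)
  finally show ?thesis
    by (simp add: kernel_comp_def sum_distrib_right mult.assoc)
qed

lemma translation_invariant_comp:
  assumes "N \<ge> 1" "translation_invariant N f" "translation_invariant N g"
  shows "translation_invariant N (kernel_comp N f g)"
  unfolding translation_invariant_def
proof (intro allI ballI)
  fix a x y assume x: "x \<in> torus N" and y: "y \<in> torus N"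
  have "kernel_comp N f g (wrap N (x + a)) (wrap N (y + a))
      = (\<Sum>v\<in>torus N. f (wrap N (x + a)) (wrap N (v + a)) * g (wrap N (v + a)) (wrap N (y + a)))"
    unfolding kernel_comp_def
    by (rule sum.reindex_bij_betw[OF bij_betw_torus_translate[OF assms(1)], symmetric])
  also have "\<dots> = kernel_comp N f g x y"
    unfolding kernel_comp_def
    using x y by (intro sum.cong) (auto simp: translation_invariantD assms)
  finally show "kernel_comp N f g (wrap N (x + a)) (wrap N (y + a)) = kernel_comp N f g x y" .
qed

lemma translation_invariant_transpose:
  "translation_invariant N f \<Longrightarrow> translation_invariant N (\<lambda>x y. f y x)"
  by (simp add: translation_invariant_def)

text \<open>The torus is an abelian group, and the reflection \<open>v \<mapsto> x + y - v\<close> interchanges the two factors.\<close>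

lemma kernel_comp_commute:
  assumes N: "N \<ge> 1" and f: "translation_invariant N f" and g: "translation_invariant N g"
    and x: "x \<in> torus N" and y: "y \<in> torus N"
  shows "kernel_comp N f g x y = kernel_comp N g f x y"
proof -
  have "kernel_comp N f g x y
      = (\<Sum>v\<in>torus N. f x (wrap N (x + y - v)) * g (wrap N (x + y - v)) y)"
    unfolding kernel_comp_def
    by (rule sum.reindex_bij_betw[OF bij_betw_torus_reflect[OF N], symmetric])
  also have "\<dots> = (\<Sum>v\<in>torus N. g x v * f v y)"
  proof (rule sum.cong[OF refl])
    fix v assume v: "v \<in> torus N"
    let ?w = "wrap N (x + y - v)"
    \<comment> \<open>Translation by \<open>v - x\<close> takes \<open>(x, ?w)\<close> to
      \<open>(v, y)\<close>, and translation by \<open>v - y\<close> takes \<open>(?w, y)\<close> to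
      \<open>(x, v)\<close>.\<close>
    have "f x ?w = f v y"
      using translation_invariantD[OF f x, of ?w "v - x"] N v y
      by (simp add: wrap_torus)
    moreover have "g ?w y = g x v"
      using translation_invariantD[OF g _ y, of ?w "v - y"] N v x
      by (simp add: wrap_torus)
    ultimately show "f x ?w * g ?w y = g x v * f v y"
      by simp
  qed
  finally show ?thesis
    by (simp add: kernel_comp_def)
qed

text \<open>Composing with the constant kernel \<open>1\<close> on the right gives row sums and on
  the left column sums; the two kernels commute.\<close>

lemma column_sum_eq:
  assumes N: "N \<ge> 1" and f: "translation_invariant N f" and x: "x \<in> torus N" and y: "y \<in> torus N"
  shows "(\<Sum>v\<in>torus N. f v y) = (\<Sum>v\<in>torus N. f x v)"
proof -
  have "translation_invariant N (\<lambda>_ _. 1)"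
    by (simp only: translation_invariant_def) simp
  from kernel_comp_commute[OF N f this x y] show ?thesis
    by (simp add: kernel_comp_def)
qed

text \<open>Every move, staying put included, takes the form \<open>wrap N (u + e)\<close>, so that
  one argument about translations serves all five.\<close>

lemma torus_step_eq:
  assumes "u \<in> torus N"
  shows "torus_step N p u v = p 0 * of_bool (v = wrap N (u + (0, 0)))
    + p 1 * of_bool (v = wrap N (u + (1, 0))) + p 2 * of_bool (v = wrap N (u + (- 1, 0)))
    + p 3 * of_bool (v = wrap N (u + (0, 1))) + p 4 * of_bool (v = wrap N (u + (0, - 1)))"
  using assms by (cases u) (auto simp: torus_step_def wrap_def torus_def)

lemma wrap_translate_eq_iff:
  assumes "N \<ge> 1" "y \<in> torus N"
  shows "wrap N (y + a) = wrap N (x + a + e) \<longleftrightarrow> y = wrap N (x + e)"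
proof
  assume "wrap N (y + a) = wrap N (x + a + e)"
  then have "wrap N (wrap N (y + a) - a) = wrap N (wrap N (x + a + e) - a)"
    by simp
  then show "y = wrap N (x + e)"
    using assms by (simp add: wrap_torus algebra_simps)
next
  assume y: "y = wrap N (x + e)"
  show "wrap N (y + a) = wrap N (x + a + e)"
    unfolding y wrap_add_left by (simp add: ac_simps)
qed

lemma translation_invariant_torus_step:
  assumes "N \<ge> 1"
  shows "translation_invariant N (torus_step N p)"
  unfolding translation_invariant_def
proof (intro allI ballI)
  fix a x y assume "x \<in> torus N" "y \<in> torus N"
  then show "torus_step N p (wrap N (x + a)) (wrap N (y + a)) = torus_step N p x y"
    using assms by (simp only: torus_step_eq wrap_in_torus wrap_add_left wrap_translate_eq_iff)
qed

lemma torus_step_nonneg: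
  assumes "\<And>i. i \<le> 4 \<Longrightarrow> p i \<ge> 0"
  shows "torus_step N p u v \<ge> 0"
  unfolding torus_step_def
  by (simp only: split: prod.split, intro allI impI add_nonneg_nonneg mult_nonneg_nonneg assms) simp_all

lemma sum_torus_step_target:
  assumes "N \<ge> 1" "u \<in> torus N"
  shows "(\<Sum>v\<in>torus N. torus_step N p u v) = p 0 + p 1 + p 2 + p 3 + p 4"
proof -
  have "(\<Sum>v\<in>torus N. c * of_bool (v = wrap N a)) = c" for c :: real and a
    using assms by (subst sum.cong[OF refl, of _ _ "\<lambda>v. if v = wrap N a then c else 0"]) auto
  then show ?thesis
    using assms by (simp add: torus_step_eq sum.distrib)
qed

text \<open>Translation invariance makes the column sums equal to the row sums; for total weight 1
  the walk is thus doubly stochastic.\<close>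

lemma sum_torus_step_source:
  assumes "N \<ge> 1" "v \<in> torus N"
  shows "(\<Sum>u\<in>torus N. torus_step N p u v) = p 0 + p 1 + p 2 + p 3 + p 4"
  using column_sum_eq[OF assms(1) translation_invariant_torus_step[OF assms(1)] assms(2,2)]
    sum_torus_step_target[OF assms] by simp

section \<open>From kernels to matrices\<close>

definition kernel_mat :: "nat \<Rightarrow> kernel \<Rightarrow> real mat" where
  "kernel_mat N f = mat (N\<^sup>2) (N\<^sup>2) (\<lambda>(i, j). f (torus_vertex N i) (torus_vertex N j))"

lemma bij_betw_torus_vertex:
  assumes "N \<ge> 1"
  shows "bij_betw (torus_vertex N) {0..<N\<^sup>2} (torus N)"
proof (rule bij_betwI[where g = "\<lambda>(x, y). nat x * N + nat y"])
  show "torus_vertex N \<in> {0..<N\<^sup>2} \<rightarrow> torus N"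
    using assms by (auto simp: torus_vertex_def torus_def power2_eq_square less_mult_imp_div_less)
  show "(\<lambda>(x, y). nat x * N + nat y) \<in> torus N \<rightarrow> {0..<N\<^sup>2}"
  proof (clarsimp simp: torus_def)
    fix x y :: int assume "0 \<le> x" "0 \<le> y" "x < int N" "y < int N"
    then have "nat x * N + nat y < Suc (nat x) * N" "Suc (nat x) * N \<le> N * N"
      by (simp, intro mult_right_mono) auto
    then show "nat x * N + nat y < N\<^sup>2"
      by (simp add: power2_eq_square)
  qed
  show "(case torus_vertex N k of (x, y) \<Rightarrow> nat x * N + nat y) = k" for k
    by (simp add: torus_vertex_def)
  show "torus_vertex N (case x of (x, y) \<Rightarrow> nat x * N + nat y) = x" if "x \<in> torus N" for x
    using that assms by (auto simp: torus_vertex_def torus_def)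
qed

lemma torus_vertex_in_torus: "N \<ge> 1 \<Longrightarrow> i < N\<^sup>2 \<Longrightarrow> torus_vertex N i \<in> torus N"
  using bij_betw_torus_vertex by (fastforce simp: bij_betw_def)

lemma kernel_mat_carrier [simp]: "kernel_mat N f \<in> carrier_mat (N\<^sup>2) (N\<^sup>2)"
  by (simp add: kernel_mat_def)

lemma kernel_mat_mult:
  assumes "N \<ge> 1"
  shows "kernel_mat N f * kernel_mat N g = kernel_mat N (kernel_comp N f g)"
proof -
  have "(\<Sum>k\<in>{0..<N\<^sup>2}. f x (torus_vertex N k) * g (torus_vertex N k) y) = kernel_comp N f g x y" for x y
    unfolding kernel_comp_def by (rule sum.reindex_bij_betw[OF bij_betw_torus_vertex[OF assms]])
  then show ?thesis
    by (intro eq_matI) (simp_all add: kernel_mat_def scalar_prod_def)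
qed

lemma kernel_mat_cong:
  assumes "N \<ge> 1" "\<And>x y. x \<in> torus N \<Longrightarrow> y \<in> torus N \<Longrightarrow> f x y = g x y"
  shows "kernel_mat N f = kernel_mat N g"
  using assms by (intro eq_matI) (simp_all add: kernel_mat_def torus_vertex_in_torus)

lemma ones_mat_eq_kernel_mat: "ones_mat (N\<^sup>2) = kernel_mat N (\<lambda>_ _. 1)"
  by (simp add: ones_mat_def kernel_mat_def split_def)

section \<open>The Green function of the walk killed at the meeting time\<close>

text \<open>The probability that two walkers with independent uniform starting points are at \<open>x\<close> and \<open>y\<close>
  at time \<open>t\<close> and have not met up to and including time \<open>t\<close>.\<close>

fun unmet :: "'s set \<Rightarrow> ('s \<Rightarrow> 's \<Rightarrow> real) \<Rightarrow> nat \<Rightarrow> 's \<Rightarrow> 's \<Rightarrow> real" where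
  "unmet S K 0 x y = of_bool (x \<noteq> y) / real (card S) ^ 2"
| "unmet S K (Suc t) x y =
     of_bool (x \<noteq> y) * (\<Sum>x'\<in>S. \<Sum>y'\<in>S. unmet S K t x' y' * (K x' x * K y' y))"

lemma unmet_diag [simp]: "unmet S K t x x = 0"
  by (cases t) simp_all

lemma unmet_nonneg:
  assumes "\<And>u v. K u v \<ge> 0"
  shows "unmet S K t x y \<ge> 0"
  by (induction t arbitrary: x y) (auto intro!: sum_nonneg mult_nonneg_nonneg assms)

text \<open>The recursion is linear with nonnegative coefficients, so a comparison of time
  \<open>T\<close> with time \<open>0\<close> propagates to \<open>t + T\<close> and
  \<open>t\<close>.\<close>

lemma unmet_contraction:
  assumes K: "\<And>u v. K u v \<ge> 0"
    and T: "\<And>x y. x \<in> S \<Longrightarrow> y \<in> S \<Longrightarrow> unmet S K T x y \<le> c * unmet S K 0 x y"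
    and "x \<in> S" "y \<in> S"
  shows "unmet S K (t + T) x y \<le> c * unmet S K t x y"
  using assms(3,4)
proof (induction t arbitrary: x y)
  case 0
  then show ?case using T by (simp only: add_0)
next
  case (Suc t)
  have "(\<Sum>x'\<in>S. \<Sum>y'\<in>S. unmet S K (t + T) x' y' * (K x' x * K y' y))
      \<le> (\<Sum>x'\<in>S. \<Sum>y'\<in>S. c * unmet S K t x' y' * (K x' x * K y' y))"
    by (intro sum_mono mult_right_mono Suc.IH mult_nonneg_nonneg K)
  also have "\<dots> = c * (\<Sum>x'\<in>S. \<Sum>y'\<in>S. unmet S K t x' y' * (K x' x * K y' y))"
    by (simp add: sum_distrib_left mult.assoc)
  finally show ?case
    by simp
qed

text \<open>Each partial sum is at most the sum of the first \<open>T\<close> terms plus half of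
  itself.\<close>

lemma summable_if_shift_contracts:
  fixes f :: "nat \<Rightarrow> real"
  assumes nonneg: "\<And>t. f t \<ge> 0" and half: "\<And>t. f (t + T) \<le> f t / 2"
  shows "summable f"
proof (rule bounded_imp_summable[OF nonneg])
  fix m
  have shift: "sum f {..<k + T} = sum f {..<T} + (\<Sum>t<k. f (t + T))" for k
    by (induction k) simp_all
  have "sum f {..m} \<le> sum f {..<Suc m + T}"
    by (rule sum_mono2) (auto simp: nonneg)
  also have "\<dots> = sum f {..<T} + (\<Sum>t<Suc m. f (t + T))"
    by (rule shift)
  also have "\<dots> \<le> sum f {..<T} + (\<Sum>t<Suc m. f t / 2)"
    by (intro add_left_mono sum_mono half)
  also have "\<dots> = sum f {..<T} + sum f {..m} / 2"
    by (simp only: sum_divide_distrib lessThan_Suc_atMost)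
  finally show "sum f {..m} \<le> 2 * sum f {..<T}"
    by simp
qed

text \<open>Once all entries have dropped to half of the constant initial value, linearity and
  monotonicity of the recursion halve them again in every further period.\<close>

lemma summable_unmet:
  assumes S: "finite S" and K: "\<And>u v. K u v \<ge> 0"
    and lim: "(\<lambda>t. \<Sum>x\<in>S. \<Sum>y\<in>S. unmet S K t x y) \<longlonglongrightarrow> 0"
    and x: "x \<in> S" and y: "y \<in> S"
  shows "summable (\<lambda>t. unmet S K t x y)"
proof -
  have n: "real (card S) > 0"
    using S x by (auto simp: card_gt_0_iff)
  \<comment> \<open>The threshold is half of the common initial value of all off-diagonal entries;
    by nonnegativity the total bounds each single entry.\<close>
  have "\<forall>\<^sub>F t in sequentially. (\<Sum>x\<in>S. \<Sum>y\<in>S. unmet S K t x y) < 1 / real (card S) ^ 2 / 2"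
    using n by (intro order_tendstoD(2)[OF lim]) simp
  then obtain T where T: "(\<Sum>x\<in>S. \<Sum>y\<in>S. unmet S K T x y) < 1 / real (card S) ^ 2 / 2"
    by (auto simp: eventually_sequentially)
  have "unmet S K T a b \<le> 1 / 2 * unmet S K 0 a b" if "a \<in> S" "b \<in> S" for a b
  proof (cases "a = b")
    case False
    have "unmet S K T a b \<le> (\<Sum>y\<in>S. unmet S K T a y)"
      using S that K by (intro member_le_sum unmet_nonneg) auto
    also have "\<dots> \<le> (\<Sum>x\<in>S. \<Sum>y\<in>S. unmet S K T x y)"
      using S that K by (intro member_le_sum[where f = "\<lambda>x. \<Sum>y\<in>S. unmet S K T x y"] sum_nonneg unmet_nonneg) auto
    finally show ?thesis
      using T False by simp
  qed simp
  then have "unmet S K (t + T) x y \<le> 1 / 2 * unmet S K t x y" for t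
    by (intro unmet_contraction K x y)
  then show ?thesis
    by (intro summable_if_shift_contracts[where T = T] unmet_nonneg K) simp
qed

text \<open>The matrix called \<open>U\<close> in the overview. The series has its intended value
  only under summability, which the lemmas about convergence and the first-step equation therefore
  assume.\<close>

definition green :: "'s set \<Rightarrow> ('s \<Rightarrow> 's \<Rightarrow> real) \<Rightarrow> 's \<Rightarrow> 's \<Rightarrow> real" where
  "green S K x y = (\<Sum>t. unmet S K t x y)"

lemma green_diag [simp]: "green S K x x = 0"
  by (simp add: green_def)

lemma sums_green:
  assumes "\<And>x y. x \<in> S \<Longrightarrow> y \<in> S \<Longrightarrow> summable (\<lambda>t. unmet S K t x y)"
  shows "(\<lambda>t. \<Sum>x\<in>S. \<Sum>y\<in>S. unmet S K t x y) sums (\<Sum>x\<in>S. \<Sum>y\<in>S. green S K x y)"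
  unfolding green_def by (intro sums_sum summable_sums assms)

text \<open>Time \<open>0\<close> contributes the constant, and the recursion is summed over all
  later times. Off the diagonal the killing factor is 1.\<close>

lemma green_eq:
  assumes summable: "\<And>x y. x \<in> S \<Longrightarrow> y \<in> S \<Longrightarrow> summable (\<lambda>t. unmet S K t x y)"
    and x: "x \<in> S" and y: "y \<in> S" and "x \<noteq> y"
  shows "green S K x y = 1 / real (card S) ^ 2
    + (\<Sum>x'\<in>S. \<Sum>y'\<in>S. green S K x' y' * (K x' x * K y' y))"
proof -
  have "(\<lambda>t. \<Sum>x'\<in>S. \<Sum>y'\<in>S. unmet S K t x' y' * (K x' x * K y' y))
      sums (\<Sum>x'\<in>S. \<Sum>y'\<in>S. green S K x' y' * (K x' x * K y' y))"
    unfolding green_def by (intro sums_sum sums_mult2 summable_sums summable)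
  then have "(\<lambda>t. unmet S K (Suc t) x y)
      sums (\<Sum>x'\<in>S. \<Sum>y'\<in>S. green S K x' y' * (K x' x * K y' y))"
    using \<open>x \<noteq> y\<close> by simp
  from sums_unique[OF this] show ?thesis
    unfolding green_def using suminf_split_head[OF summable[OF x y]] \<open>x \<noteq> y\<close>
    by simp
qed

text \<open>One step of the recursion has the form \<open>K\<^sup>T u K\<close>, cut down to the
  off-diagonal entries. Products, transposes and this restriction all preserve translation
  invariance.\<close>

lemma translation_invariant_unmet:
  assumes N: "N \<ge> 1" and K: "translation_invariant N K"
  shows "translation_invariant N (unmet (torus N) K t)"
proof -
  have neq: "wrap N (x + a) = wrap N (y + a) \<longleftrightarrow> x = y" if "x \<in> torus N" "y \<in> torus N" for x y a
    using wrap_translate_eq_iff[OF N that(1), of a y 0] that by (simp add: wrap_torus)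
  show ?thesis
  proof (induction t)
  case 0
  then show ?case
    unfolding translation_invariant_def unmet.simps
    by (intro allI ballI) (simp only: neq)
next
  case (Suc t)
  let ?f = "kernel_comp N (\<lambda>x y. K y x) (kernel_comp N (unmet (torus N) K t) K)"
  have f: "translation_invariant N ?f"
    by (rule translation_invariant_comp[OF N translation_invariant_transpose[OF K]
          translation_invariant_comp[OF N Suc.IH K]])
  have eq: "unmet (torus N) K (Suc t) x y = of_bool (x \<noteq> y) * ?f x y" for x y
    by (simp add: kernel_comp_def sum_distrib_left mult_ac)
  show ?case
    unfolding translation_invariant_def eq
    by (intro allI ballI) (simp only: neq translation_invariantD[OF f])
  qed
qed

lemma translation_invariant_green:
  assumes "N \<ge> 1" "translation_invariant N K"
  shows "translation_invariant N (green (torus N) K)"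
  using translation_invariantD[OF translation_invariant_unmet[OF assms]]
  unfolding translation_invariant_def green_def by simp

section \<open>The Laplacian applied to the Green function\<close>

lemma meeting_laplacian_eq:
  assumes "N \<ge> 1"
  shows "meeting_laplacian N p = 1\<^sub>m (N\<^sup>2)
    - kernel_mat N (kernel_comp N (torus_step N p) (\<lambda>x y. torus_step N p y x))"
proof -
  have "transition_mat N p = kernel_mat N (torus_step N p)"
    by (simp add: transition_mat_def kernel_mat_def)
  moreover have "transpose_mat (transition_mat N p) = kernel_mat N (\<lambda>x y. torus_step N p y x)"
    by (intro eq_matI) (simp_all add: transition_mat_def kernel_mat_def)
  ultimately show ?thesis
    by (simp add: meeting_laplacian_def kernel_mat_mult[OF assms])
qed

text \<open>The Green matrix meets the conditions of \<open>sum_inverse_eigenvalues\<close>, with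
  \<open>s\<close> the common value of its row and column sums; its \<open>N\<^sup>2\<close> rows
  add up to \<open>N\<^sup>2 * s\<close>.\<close>

lemma sum_green_torus:
  fixes p :: "nat \<Rightarrow> real"
  assumes N: "N \<ge> 1"
    and p_sum: "p 0 + p 1 + p 2 + p 3 + p 4 = 1"
    and eigenvalues: "char_poly (meeting_laplacian N p) = (\<Prod>i<N\<^sup>2. [:- lam i, 1:])"
    and summable: "\<And>x y. x \<in> torus N \<Longrightarrow> y \<in> torus N \<Longrightarrow>
      summable (\<lambda>t. unmet (torus N) (torus_step N p) t x y)"
  shows "(\<Sum>x\<in>torus N. \<Sum>y\<in>torus N. green (torus N) (torus_step N p) x y)
    = (\<Sum>i | i < N\<^sup>2 \<and> lam i \<noteq> 0. inverse (lam i))"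
proof -
  let ?K = "torus_step N p" and ?n = "N\<^sup>2"
  let ?KT = "\<lambda>x y. ?K y x"
  let ?Q = "kernel_comp N ?K ?KT"
  define u where "u = green (torus N) ?K"
  define s where "s = (\<Sum>v\<in>torus N. u v (0, 0))"
  \<comment> \<open>The defect in the first-step equation; commutation later identifies it with the
    Laplacian applied to \<open>u\<close>.\<close>
  define D where "D x y = u x y - kernel_comp N ?KT (kernel_comp N u ?K) x y" for x y
  have n: "?n \<ge> 1"
    using N by simp
  have K: "translation_invariant N ?K" and KT: "translation_invariant N ?KT"
    using translation_invariant_torus_step[OF N] translation_invariant_transpose by blast+
  have u: "translation_invariant N u"
    unfolding u_def by (intro translation_invariant_green N K)
  have K1: "(\<Sum>v\<in>torus N. ?K x v) = 1" "(\<Sum>v\<in>torus N. ?K v x) = 1" if "x \<in> torus N" for x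
    using sum_torus_step_target[OF N that] sum_torus_step_source[OF N that] p_sum by auto
  have zero: "(0, 0) \<in> torus N"
    using N by (simp add: torus_def)
  have row: "(\<Sum>v\<in>torus N. u x v) = s" if "x \<in> torus N" for x
    unfolding s_def using column_sum_eq[OF N u that zero] by simp
  have col: "(\<Sum>v\<in>torus N. u v x) = s" if "x \<in> torus N" for x
    using column_sum_eq[OF N u that that] row[OF that] by simp
  have off_diag: "D x y = 1 / real ?n ^ 2" if "x \<in> torus N" "y \<in> torus N" "x \<noteq> y" for x y
    using green_eq[OF summable that]
    by (simp add: D_def u_def kernel_comp_def card_torus sum_distrib_left mult_ac)
  \<comment> \<open>Double stochasticity of the walk gives \<open>K\<^sup>T u K\<close> the same
    column sums \<open>s\<close> as \<open>u\<close>.\<close>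
  have D_col: "(\<Sum>x\<in>torus N. D x y) = 0" if y: "y \<in> torus N" for y
  proof -
    let ?W = "kernel_comp N u ?K"
    have "(\<Sum>x\<in>torus N. kernel_comp N ?KT ?W x y) = (\<Sum>v\<in>torus N. \<Sum>x\<in>torus N. ?K v x * ?W v y)"
      unfolding kernel_comp_def[of N ?KT] by (rule sum.swap)
    also have "\<dots> = (\<Sum>v\<in>torus N. ?W v y)"
      by (simp add: sum_distrib_right[symmetric] K1)
    also have "\<dots> = (\<Sum>w\<in>torus N. \<Sum>v\<in>torus N. u v w * ?K w y)"
      unfolding kernel_comp_def by (rule sum.swap)
    also have "\<dots> = s"
      by (simp add: sum_distrib_right[symmetric] col sum_distrib_left[symmetric] K1 y)
    finally show ?thesis
      by (simp add: D_def sum_subtractf col y)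
  qed
  have D: "D x y = 1 / real ?n ^ 2 - 1 / real ?n * of_bool (x = y)"
    if x: "x \<in> torus N" and y: "y \<in> torus N" for x y
  proof (cases "x = y")
    case True
    \<comment> \<open>The diagonal entry is forced: it must cancel the other \<open>n - 1\<close>
      entries of its column, each equal to \<open>1 / n\<^sup>2\<close>.\<close>
    have "0 = D y y + (\<Sum>v\<in>torus N - {y}. D v y)"
      using D_col[OF y] y by (simp add: sum.remove)
    also have "(\<Sum>v\<in>torus N - {y}. D v y) = (\<Sum>v\<in>torus N - {y}. 1 / real ?n ^ 2)"
      using y by (intro sum.cong) (auto simp: off_diag)
    also have "\<dots> = (real ?n - 1) / real ?n ^ 2"
      using n y by (simp add: card_torus of_nat_diff)
    finally show ?thesis
      using n True by (simp add: field_simps power2_eq_square)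
  qed (simp add: off_diag that)
  \<comment> \<open>Two commutations:
    \<open>K K\<^sup>T u = K\<^sup>T K u = K\<^sup>T u K\<close>.\<close>
  have Qu: "kernel_comp N ?Q u x y = kernel_comp N ?KT (kernel_comp N u ?K) x y"
    if x: "x \<in> torus N" and y: "y \<in> torus N" for x y
  proof -
    have "kernel_comp N ?Q u x y = kernel_comp N (kernel_comp N ?KT ?K) u x y"
      by (intro kernel_comp_cong kernel_comp_commute N K KT x refl)
    also have "\<dots> = kernel_comp N ?KT (kernel_comp N ?K u) x y"
      by (rule kernel_comp_assoc[symmetric])
    also have "\<dots> = kernel_comp N ?KT (kernel_comp N u ?K) x y"
      by (intro kernel_comp_cong kernel_comp_commute N K u y refl)
    finally show ?thesis .
  qed
  let ?L = "meeting_laplacian N p" and ?U = "kernel_mat N u"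
  have L: "?L = 1\<^sub>m ?n - kernel_mat N ?Q"
    by (rule meeting_laplacian_eq[OF N])
  have L_carrier: "?L \<in> carrier_mat ?n ?n"
    by (simp add: L minus_carrier_mat)
  have "?L * ?U = ?U - kernel_mat N (kernel_comp N ?Q u)"
    unfolding L by (subst minus_mult_distrib_mat[of _ ?n ?n _ _ ?n])
      (simp_all add: kernel_mat_mult[OF N] left_mult_one_mat[OF kernel_mat_carrier])
  also have "\<dots> = kernel_mat N D"
    using N by (intro eq_matI) (simp_all add: kernel_mat_def D_def torus_vertex_in_torus Qu)
  also have "\<dots> = (1 / real ?n ^ 2) \<cdot>\<^sub>m ones_mat ?n - (1 / real ?n) \<cdot>\<^sub>m 1\<^sub>m ?n"
  proof (intro eq_matI)
    fix i j assume ij: "i < dim_row ((1 / real ?n ^ 2) \<cdot>\<^sub>m ones_mat ?n - (1 / real ?n) \<cdot>\<^sub>m 1\<^sub>m ?n)"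
      "j < dim_col ((1 / real ?n ^ 2) \<cdot>\<^sub>m ones_mat ?n - (1 / real ?n) \<cdot>\<^sub>m 1\<^sub>m ?n)"
    then have ij': "i < ?n" "j < ?n"
      by simp_all
    then have "torus_vertex N i = torus_vertex N j \<longleftrightarrow> i = j"
      using bij_betw_torus_vertex[OF N] by (auto simp: bij_betw_def inj_on_def)
    then show "kernel_mat N D $$ (i, j) = ((1 / real ?n ^ 2) \<cdot>\<^sub>m ones_mat ?n - (1 / real ?n) \<cdot>\<^sub>m 1\<^sub>m ?n) $$ (i, j)"
      using ij' N by (simp add: kernel_mat_def D torus_vertex_in_torus)
  qed (simp_all add: kernel_mat_def)
  finally have LU: "?L * ?U = (1 / real ?n ^ 2) \<cdot>\<^sub>m ones_mat ?n - (1 / real ?n) \<cdot>\<^sub>m 1\<^sub>m ?n" .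
  \<comment> \<open>The rows of \<open>K K\<^sup>T\<close> sum to 1 by the column sums and then the
    row sums of \<open>K\<close>; hence \<open>L J = 0\<close>.\<close>
  have "kernel_comp N ?Q (\<lambda>_ _. 1) x y = 1" if "x \<in> torus N" for x y
  proof -
    have "kernel_comp N ?Q (\<lambda>_ _. 1) x y = (\<Sum>v\<in>torus N. \<Sum>w\<in>torus N. ?K x w * ?K v w)"
      by (simp add: kernel_comp_def)
    also have "\<dots> = (\<Sum>w\<in>torus N. \<Sum>v\<in>torus N. ?K x w * ?K v w)"
      by (rule sum.swap)
    finally show ?thesis
      using that by (simp add: sum_distrib_left[symmetric] K1)
  qed
  then have "kernel_mat N ?Q * ones_mat ?n = ones_mat ?n"
    unfolding ones_mat_eq_kernel_mat kernel_mat_mult[OF N] by (intro kernel_mat_cong N)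
  then have LJ: "?L * ones_mat ?n = 0\<^sub>m ?n ?n"
    unfolding L by (subst minus_mult_distrib_mat[of _ ?n ?n _ _ ?n]) (simp_all add: minus_r_inv_mat)
  have "ones_mat ?n * ?U = kernel_mat N (\<lambda>_ _. s)"
    unfolding ones_mat_eq_kernel_mat kernel_mat_mult[OF N]
    by (intro kernel_mat_cong N) (simp add: kernel_comp_def col)
  also have "\<dots> = s \<cdot>\<^sub>m ones_mat ?n"
    by (intro eq_matI) (simp_all add: kernel_mat_def)
  finally have JU: "ones_mat ?n * ?U = s \<cdot>\<^sub>m ones_mat ?n" .
  have "?U $$ (i, i) = 0" if "i < ?n" for i
    using that by (simp add: kernel_mat_def u_def)
  from sum_inverse_eigenvalues[OF n L_carrier kernel_mat_carrier LJ eigenvalues this JU LU]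
  show ?thesis
    by (simp add: u_def[symmetric] row card_torus)
qed

section \<open>The law of the two walks up to the meeting time\<close>

lemma less_meeting_time_iff:
  "enat t < meeting_time X Y \<omega> \<longleftrightarrow> (\<forall>s\<le>t. X s \<omega> \<noteq> Y s \<omega>)"
proof -
  have "enat t < meeting_time X Y \<omega> \<longleftrightarrow> enat (Suc t) \<le> meeting_time X Y \<omega>"
    by (simp add: Suc_ile_eq)
  also have "\<dots> \<longleftrightarrow> (\<forall>s. X s \<omega> = Y s \<omega> \<longrightarrow> Suc t \<le> s)"
    by (simp add: meeting_time_def le_INF_iff)
  also have "\<dots> \<longleftrightarrow> (\<forall>s\<le>t. X s \<omega> \<noteq> Y s \<omega>)"
    by (meson not_less_eq_eq)
  finally show ?thesis .
qed

lemma markov_chain_measurable: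
  "markov_chain M S K X \<Longrightarrow> X t \<in> measurable M (count_space S)"
  by (simp add: markov_chain_def)

text \<open>The Markov property speaks only of histories of positive probability; for a null history
  both sides vanish by monotonicity.\<close>

lemma (in prob_space) markov_chain_path_Suc:
  assumes X: "markov_chain M S K X" and "u (Suc t) \<in> S"
  shows "\<P>(\<omega> in M. \<forall>s\<le>Suc t. X s \<omega> = u s) = \<P>(\<omega> in M. \<forall>s\<le>t. X s \<omega> = u s) * K (u t) (u (Suc t))"
proof -
  note [measurable] = markov_chain_measurable[OF X]
  have eq: "{\<omega> \<in> space M. \<forall>s\<le>Suc t. X s \<omega> = u s}
      = {\<omega> \<in> space M. X (Suc t) \<omega> = u (Suc t) \<and> (\<forall>s\<le>t. X s \<omega> = u s)}"
    by (auto simp: le_Suc_eq)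
  show ?thesis
  proof (cases "\<P>(\<omega> in M. \<forall>s\<le>t. X s \<omega> = u s) > 0")
    case True
    then have "\<P>(\<omega> in M. X (Suc t) \<omega> = u (Suc t) \<bar> \<forall>s\<le>t. X s \<omega> = u s) = K (u t) (u (Suc t))"
      using X \<open>u (Suc t) \<in> S\<close> unfolding markov_chain_def by blast
    then show ?thesis
      using True unfolding cond_prob_def eq by (simp add: field_simps)
  next
    case False
    then have 0: "\<P>(\<omega> in M. \<forall>s\<le>t. X s \<omega> = u s) = 0"
      using measure_nonneg[of M "{\<omega> \<in> space M. \<forall>s\<le>t. X s \<omega> = u s}"] by linarith
    have "\<P>(\<omega> in M. \<forall>s\<le>Suc t. X s \<omega> = u s) \<le> \<P>(\<omega> in M. \<forall>s\<le>t. X s \<omega> = u s)"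
      by (rule finite_measure_mono) (auto intro: measurable_sets)
    then show ?thesis
      using 0 measure_nonneg[of M "{\<omega> \<in> space M. \<forall>s\<le>Suc t. X s \<omega> = u s}"] by simp
  qed
qed

section \<open>Two independent walks on a finite state space\<close>

locale independent_walks = prob_space M
  for M :: "'w measure" +
  fixes S :: "'s set" and K :: "'s \<Rightarrow> 's \<Rightarrow> real" and X Y :: "nat \<Rightarrow> 'w \<Rightarrow> 's"
  assumes S: "finite S"
    and X: "markov_chain M S K X"
    and Y: "markov_chain M S K Y"
    and indep: "indep_var
        (\<Pi>\<^sub>M t\<in>UNIV. count_space S) (\<lambda>\<omega> t. X t \<omega>)
        (\<Pi>\<^sub>M t\<in>UNIV. count_space S) (\<lambda>\<omega> t. Y t \<omega>)"
begin

lemma measurable_walks [measurable]: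
  "X t \<in> measurable M (count_space S)" "Y t \<in> measurable M (count_space S)"
  using X Y by (auto intro: markov_chain_measurable)

lemma walks_in [simp]:
  assumes "\<omega> \<in> space M"
  shows "X t \<omega> \<in> S" "Y t \<omega> \<in> S"
  using measurable_space[OF measurable_walks(1) assms] measurable_space[OF measurable_walks(2) assms]
  by simp_all

lemma sets_walk_eq [measurable]:
  "{\<omega> \<in> space M. X s \<omega> = a} \<in> sets M" "{\<omega> \<in> space M. Y s \<omega> = a} \<in> sets M"
proof -
  \<comment> \<open>The intersection with \<open>S\<close> covers the case that \<open>a\<close>
    lies outside \<open>S\<close>, where \<open>{a}\<close> is not a measurable set of the target
    space.\<close>
  have "{\<omega> \<in> space M. X s \<omega> = a} = X s -` ({a} \<inter> S) \<inter> space M"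
       "{\<omega> \<in> space M. Y s \<omega> = a} = Y s -` ({a} \<inter> S) \<inter> space M"
    by auto
  moreover have "X s -` ({a} \<inter> S) \<inter> space M \<in> sets M" "Y s -` ({a} \<inter> S) \<inter> space M \<in> sets M"
    by (intro measurable_sets[OF measurable_walks(1)] measurable_sets[OF measurable_walks(2)], simp)+
  ultimately show "{\<omega> \<in> space M. X s \<omega> = a} \<in> sets M" "{\<omega> \<in> space M. Y s \<omega> = a} \<in> sets M"
    by simp_all
qed

lemma sets_walks_meet [measurable]: "{\<omega> \<in> space M. X s \<omega> = Y s \<omega>} \<in> sets M"
proof -
  have "{\<omega> \<in> space M. X s \<omega> = Y s \<omega>}
      = (\<Union>a\<in>S. {\<omega> \<in> space M. X s \<omega> = a} \<inter> {\<omega> \<in> space M. Y s \<omega> = a})"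
    by auto
  then show ?thesis
    using S by auto
qed

lemma sets_apart [measurable]: "{\<omega> \<in> space M. \<forall>s\<le>t. X s \<omega> \<noteq> Y s \<omega>} \<in> sets M"
proof -
  have "{\<omega> \<in> space M. \<forall>s\<le>t. X s \<omega> \<noteq> Y s \<omega>}
      = space M - (\<Union>s\<le>t. {\<omega> \<in> space M. X s \<omega> = Y s \<omega>})"
    by auto
  then show ?thesis
    by auto
qed

lemma sets_paths: "{\<omega> \<in> space M. \<forall>s\<le>t. X s \<omega> = u s \<and> Y s \<omega> = v s} \<in> sets M"
proof -
  have "{\<omega> \<in> space M. \<forall>s\<le>t. X s \<omega> = u s \<and> Y s \<omega> = v s}
      = (\<Inter>s\<le>t. {\<omega> \<in> space M. X s \<omega> = u s} \<inter> {\<omega> \<in> space M. Y s \<omega> = v s})"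
    by auto
  then show ?thesis
    by auto
qed

text \<open>A prescribed initial segment is a cylinder set in the product space, so the independence
  of whole trajectories applies.\<close>

lemma prob_paths_indep:
  "\<P>(\<omega> in M. \<forall>s\<le>t. X s \<omega> = u s \<and> Y s \<omega> = v s)
    = \<P>(\<omega> in M. \<forall>s\<le>t. X s \<omega> = u s) * \<P>(\<omega> in M. \<forall>s\<le>t. Y s \<omega> = v s)"
proof -
  let ?P = "\<Pi>\<^sub>M t\<in>(UNIV :: nat set). count_space S"
  let ?A = "\<lambda>w. {f \<in> space ?P. \<forall>s\<le>t. f s = w s}"
  have A: "?A w \<in> sets ?P" for w
  proof -
    have "{f \<in> space ?P. f s = w s} \<in> sets ?P" for s
    proof -
      have "{f \<in> space ?P. f s = w s} = (\<lambda>f. f s) -` ({w s} \<inter> S) \<inter> space ?P"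
        by (auto simp: space_PiM PiE_def Pi_def)
      also have "\<dots> \<in> sets ?P"
        by (rule measurable_sets[OF measurable_component_singleton]) auto
      finally show ?thesis .
    qed
    moreover have "?A w = (\<Inter>s\<le>t. {f \<in> space ?P. f s = w s})"
      by auto
    ultimately show ?thesis
      by auto
  qed
  have sp: "(\<lambda>t. X t \<omega>) \<in> space ?P" "(\<lambda>t. Y t \<omega>) \<in> space ?P" if "\<omega> \<in> space M" for \<omega>
    using that by (auto simp: space_PiM)
  have "{\<omega> \<in> space M. \<forall>s\<le>t. X s \<omega> = u s \<and> Y s \<omega> = v s}
      = (\<lambda>\<omega>. (\<lambda>t. X t \<omega>, \<lambda>t. Y t \<omega>)) -` (?A u \<times> ?A v) \<inter> space M"
    using sp by auto
  moreover have "{\<omega> \<in> space M. \<forall>s\<le>t. X s \<omega> = u s} = (\<lambda>\<omega> t. X t \<omega>) -` ?A u \<inter> space M"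
    using sp by auto
  moreover have "{\<omega> \<in> space M. \<forall>s\<le>t. Y s \<omega> = v s} = (\<lambda>\<omega> t. Y t \<omega>) -` ?A v \<inter> space M"
    using sp by auto
  ultimately show ?thesis
    using indep_varD[OF indep A A, of u v] by simp
qed

lemma prob_paths_Suc:
  assumes "u (Suc t) \<in> S" "v (Suc t) \<in> S"
  shows "\<P>(\<omega> in M. \<forall>s\<le>Suc t. X s \<omega> = u s \<and> Y s \<omega> = v s)
    = \<P>(\<omega> in M. \<forall>s\<le>t. X s \<omega> = u s \<and> Y s \<omega> = v s) * (K (u t) (u (Suc t)) * K (v t) (v (Suc t)))"
  unfolding prob_paths_indep markov_chain_path_Suc[where u = u and t = t, OF X assms(1)]
    markov_chain_path_Suc[where u = v and t = t, OF Y assms(2)]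
  by simp

text \<open>Extensional functions make this set finite and let the values up to time
  \<open>t\<close> determine a path.\<close>

definition paths :: "nat \<Rightarrow> ((nat \<Rightarrow> 's) \<times> (nat \<Rightarrow> 's)) set" where
  "paths t = {(u, v). u \<in> {..t} \<rightarrow>\<^sub>E S \<and> v \<in> {..t} \<rightarrow>\<^sub>E S \<and> (\<forall>s\<le>t. u s \<noteq> v s)}"

lemma finite_paths: "finite (paths t)"
proof (rule finite_subset)
  show "paths t \<subseteq> ({..t} \<rightarrow>\<^sub>E S) \<times> ({..t} \<rightarrow>\<^sub>E S)"
    by (auto simp: paths_def)
  show "finite (({..t} \<rightarrow>\<^sub>E S) \<times> ({..t} \<rightarrow>\<^sub>E S))"
    using S by (auto intro!: finite_PiE)
qed

text \<open>The event is partitioned by the observed initial segments. The side condition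
  \<open>Q\<close> leaves room for fixing the positions at time \<open>t\<close> or at the next
  step.\<close>

lemma prob_sum_paths:
  assumes Q: "{\<omega> \<in> space M. Q \<omega>} \<in> sets M"
  shows "\<P>(\<omega> in M. Q \<omega> \<and> (\<forall>s\<le>t. X s \<omega> \<noteq> Y s \<omega>))
    = (\<Sum>(u, v)\<in>paths t. \<P>(\<omega> in M. Q \<omega> \<and> (\<forall>s\<le>t. X s \<omega> = u s \<and> Y s \<omega> = v s)))"
proof -
  let ?E = "\<lambda>(u, v). {\<omega> \<in> space M. Q \<omega> \<and> (\<forall>s\<le>t. X s \<omega> = u s \<and> Y s \<omega> = v s)}"
  have "{\<omega> \<in> space M. Q \<omega> \<and> (\<forall>s\<le>t. X s \<omega> \<noteq> Y s \<omega>)} = (\<Union>w\<in>paths t. ?E w)"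
  proof (intro equalityI subsetI)
    fix \<omega> assume \<omega>: "\<omega> \<in> {\<omega> \<in> space M. Q \<omega> \<and> (\<forall>s\<le>t. X s \<omega> \<noteq> Y s \<omega>)}"
    let ?w = "(restrict (\<lambda>s. X s \<omega>) {..t}, restrict (\<lambda>s. Y s \<omega>) {..t})"
    have "?w \<in> paths t" "\<omega> \<in> ?E ?w"
      using \<omega> by (auto simp: paths_def)
    then show "\<omega> \<in> (\<Union>w\<in>paths t. ?E w)"
      by blast
  qed (auto simp: paths_def)
  moreover have "prob (\<Union>w\<in>paths t. ?E w) = (\<Sum>w\<in>paths t. prob (?E w))"
  proof (rule finite_measure_finite_Union[OF finite_paths])
    have "?E (u, v) \<in> sets M" for u v
      unfolding prod.case by (intro sets.sets_Collect_conj Q sets_paths)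
    then show "?E ` paths t \<subseteq> sets M"
      by auto
    show "disjoint_family_on ?E (paths t)"
      unfolding disjoint_family_on_def
    proof (intro ballI impI)
      fix w w' assume w: "w \<in> paths t" "w' \<in> paths t" "w \<noteq> w'"
      obtain u v u' v' where uv: "w = (u, v)" "w' = (u', v')"
        by (cases w, cases w')
      show "?E w \<inter> ?E w' = {}"
      proof (rule ccontr)
        assume "?E w \<inter> ?E w' \<noteq> {}"
        then obtain \<omega> where "\<forall>s\<le>t. u s = u' s \<and> v s = v' s"
          unfolding uv by fastforce
        then have "u = u'" "v = v'"
          using w unfolding uv paths_def by (auto intro!: PiE_ext[of _ "{..t}" "\<lambda>_. S"])
        then show False
          using w uv by simp
      qed
    qed
  qed
  ultimately show ?thesis
    by (simp add: split_def)
qed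

section \<open>The joint law of the positions before the meeting\<close>

definition apart :: "nat \<Rightarrow> 's \<Rightarrow> 's \<Rightarrow> real" where
  "apart t x y = \<P>(\<omega> in M. (X t \<omega> = x \<and> Y t \<omega> = y) \<and> (\<forall>s\<le>t. X s \<omega> \<noteq> Y s \<omega>))"

lemma apart_eq_sum:
  "apart t x y = (\<Sum>(u, v) | (u, v) \<in> paths t \<and> (u t, v t) = (x, y).
     \<P>(\<omega> in M. \<forall>s\<le>t. X s \<omega> = u s \<and> Y s \<omega> = v s))"
proof -
  have "{\<omega> \<in> space M. X t \<omega> = x \<and> Y t \<omega> = y} \<in> sets M"
    by (intro sets.sets_Collect_conj sets_walk_eq)
  from prob_sum_paths[OF this]
  have "apart t x y = (\<Sum>(u, v)\<in>paths t. \<P>(\<omega> in M. (X t \<omega> = x \<and> Y t \<omega> = y) \<and>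
      (\<forall>s\<le>t. X s \<omega> = u s \<and> Y s \<omega> = v s)))"
    by (simp add: apart_def)
  also have "\<dots> = (\<Sum>(u, v)\<in>paths t. if (u t, v t) = (x, y)
      then \<P>(\<omega> in M. \<forall>s\<le>t. X s \<omega> = u s \<and> Y s \<omega> = v s) else 0)"
  proof (rule sum.cong[OF refl], clarify)
    fix u v
    show "\<P>(\<omega> in M. (X t \<omega> = x \<and> Y t \<omega> = y) \<and> (\<forall>s\<le>t. X s \<omega> = u s \<and> Y s \<omega> = v s))
        = (if (u t, v t) = (x, y) then \<P>(\<omega> in M. \<forall>s\<le>t. X s \<omega> = u s \<and> Y s \<omega> = v s) else 0)"
    proof (cases "(u t, v t) = (x, y)")
      case True
      then have "{\<omega> \<in> space M. (X t \<omega> = x \<and> Y t \<omega> = y) \<and> (\<forall>s\<le>t. X s \<omega> = u s \<and> Y s \<omega> = v s)}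
          = {\<omega> \<in> space M. \<forall>s\<le>t. X s \<omega> = u s \<and> Y s \<omega> = v s}"
        by auto
      then show ?thesis
        using True by simp
    next
      case False
      then have "{\<omega> \<in> space M. (X t \<omega> = x \<and> Y t \<omega> = y) \<and> (\<forall>s\<le>t. X s \<omega> = u s \<and> Y s \<omega> = v s)} = {}"
        by auto
      then show ?thesis
        using False by (simp only: measure_empty if_False)
    qed
  qed
  also have "\<dots> = (\<Sum>w\<in>paths t. if (fst w t, snd w t) = (x, y)
      then \<P>(\<omega> in M. \<forall>s\<le>t. X s \<omega> = fst w s \<and> Y s \<omega> = snd w s) else 0)"
    by (simp only: split_def)
  also have "\<dots> = (\<Sum>w\<in>{w \<in> paths t. (fst w t, snd w t) = (x, y)}.
      \<P>(\<omega> in M. \<forall>s\<le>t. X s \<omega> = fst w s \<and> Y s \<omega> = snd w s))"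
    by (rule sum.inter_filter[OF finite_paths, symmetric])
  finally show ?thesis
    by (simp add: split_def)
qed

text \<open>The one-step formula is available for full histories only, so it is applied to each pair
  of paths; the paths are then grouped by their endpoints at time \<open>t\<close>.\<close>

lemma apart_Suc:
  assumes x: "x \<in> S" and y: "y \<in> S"
  shows "apart (Suc t) x y
    = of_bool (x \<noteq> y) * (\<Sum>x'\<in>S. \<Sum>y'\<in>S. apart t x' y' * (K x' x * K y' y))"
proof (cases "x = y")
  case True
  then have "{\<omega> \<in> space M. (X (Suc t) \<omega> = x \<and> Y (Suc t) \<omega> = y) \<and> (\<forall>s\<le>Suc t. X s \<omega> \<noteq> Y s \<omega>)} = {}"
    by auto
  then show ?thesis
    using True by (simp only: apart_def measure_empty) simp
next
  case False
  let ?H = "\<lambda>(u, v). \<P>(\<omega> in M. \<forall>s\<le>t. X s \<omega> = u s \<and> Y s \<omega> = v s)"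
  let ?F = "\<lambda>(u, v). \<P>(\<omega> in M. \<forall>s\<le>t. X s \<omega> = u s \<and> Y s \<omega> = v s) * (K (u t) x * K (v t) y)"
  let ?end = "\<lambda>(u, v). (u t, v t)"
  have Q: "{\<omega> \<in> space M. X (Suc t) \<omega> = x \<and> Y (Suc t) \<omega> = y} \<in> sets M"
    by (intro sets.sets_Collect_conj sets_walk_eq)
  have "{\<omega> \<in> space M. (X (Suc t) \<omega> = x \<and> Y (Suc t) \<omega> = y) \<and> (\<forall>s\<le>Suc t. X s \<omega> \<noteq> Y s \<omega>)}
      = {\<omega> \<in> space M. (X (Suc t) \<omega> = x \<and> Y (Suc t) \<omega> = y) \<and> (\<forall>s\<le>t. X s \<omega> \<noteq> Y s \<omega>)}"
    using False by (auto simp: le_Suc_eq)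
  then have "apart (Suc t) x y = (\<Sum>(u, v)\<in>paths t. \<P>(\<omega> in M. (X (Suc t) \<omega> = x \<and> Y (Suc t) \<omega> = y) \<and>
      (\<forall>s\<le>t. X s \<omega> = u s \<and> Y s \<omega> = v s)))"
    by (simp only: apart_def prob_sum_paths[OF Q])
  also have "\<dots> = (\<Sum>w\<in>paths t. ?F w)"
  proof (rule sum.cong[OF refl], clarify)
    fix u v
    \<comment> \<open>The paths carry no information after time \<open>t\<close>; the update appends
      the new positions and leaves the history unchanged.\<close>
    let ?u = "u(Suc t := x)" and ?v = "v(Suc t := y)"
    have "{\<omega> \<in> space M. (X (Suc t) \<omega> = x \<and> Y (Suc t) \<omega> = y) \<and> (\<forall>s\<le>t. X s \<omega> = u s \<and> Y s \<omega> = v s)}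
        = {\<omega> \<in> space M. \<forall>s\<le>Suc t. X s \<omega> = ?u s \<and> Y s \<omega> = ?v s}"
      by (auto simp: le_Suc_eq)
    moreover have "{\<omega> \<in> space M. \<forall>s\<le>t. X s \<omega> = ?u s \<and> Y s \<omega> = ?v s}
        = {\<omega> \<in> space M. \<forall>s\<le>t. X s \<omega> = u s \<and> Y s \<omega> = v s}"
      by auto
    ultimately show "\<P>(\<omega> in M. (X (Suc t) \<omega> = x \<and> Y (Suc t) \<omega> = y) \<and>
        (\<forall>s\<le>t. X s \<omega> = u s \<and> Y s \<omega> = v s))
      = \<P>(\<omega> in M. \<forall>s\<le>t. X s \<omega> = u s \<and> Y s \<omega> = v s) * (K (u t) x * K (v t) y)"
      using prob_paths_Suc[of ?u t ?v] x y by simp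
  qed
  also have "\<dots> = (\<Sum>z\<in>S \<times> S. \<Sum>w\<in>{w \<in> paths t. ?end w = z}. ?F w)"
    by (rule sum.group[OF finite_paths finite_cartesian_product[OF S S], symmetric]) (auto simp: paths_def)
  also have "\<dots> = (\<Sum>(x', y')\<in>S \<times> S. apart t x' y' * (K x' x * K y' y))"
  proof (rule sum.cong[OF refl], clarify)
    fix x' y'
    have "(\<Sum>w\<in>{w \<in> paths t. ?end w = (x', y')}. ?F w)
        = (\<Sum>w\<in>{w \<in> paths t. ?end w = (x', y')}. ?H w * (K x' x * K y' y))"
      by (intro sum.cong) auto
    also have "\<dots> = (\<Sum>w\<in>{w \<in> paths t. ?end w = (x', y')}. ?H w) * (K x' x * K y' y)"
      by (rule sum_distrib_right[symmetric])
    also have "(\<Sum>w\<in>{w \<in> paths t. ?end w = (x', y')}. ?H w) = apart t x' y'"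
      unfolding apart_eq_sum by (intro sum.cong) auto
    finally show "(\<Sum>w\<in>{w \<in> paths t. ?end w = (x', y')}. ?F w) = apart t x' y' * (K x' x * K y' y)" .
  qed
  finally show ?thesis
    using False by (simp add: sum.cartesian_product)
qed

text \<open>Both sides satisfy the same recursion; at time \<open>0\<close> independence and
  uniformity give the product of two factors \<open>1 / card S\<close> off the diagonal.\<close>

lemma apart_eq_unmet:
  assumes X_init: "distr M (count_space S) (X 0) = uniform_count_measure S"
    and Y_init: "distr M (count_space S) (Y 0) = uniform_count_measure S"
    and "x \<in> S" "y \<in> S"
  shows "apart t x y = unmet S K t x y"
  using assms(3,4)
proof (induction t arbitrary: x y)
  case 0
  have init: "\<P>(\<omega> in M. Z \<omega> = a) = 1 / real (card S)"
    if "distr M (count_space S) Z = uniform_count_measure S" "Z \<in> measurable M (count_space S)" "a \<in> S"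
    for Z :: "'w \<Rightarrow> 's" and a
  proof -
    have "\<P>(\<omega> in M. Z \<omega> = a) = measure (distr M (count_space S) Z) {a}"
      using that by (subst measure_distr) (auto intro!: arg_cong[where f = "measure M"])
    also have "\<dots> = 1 / real (card S)"
      using that S by (simp add: measure_uniform_count_measure)
    finally show ?thesis .
  qed
  show ?case
  proof (cases "x = y")
    case True
    then have "{\<omega> \<in> space M. (X 0 \<omega> = x \<and> Y 0 \<omega> = y) \<and> (\<forall>s\<le>0. X s \<omega> \<noteq> Y s \<omega>)} = {}"
      by auto
    then show ?thesis
      using True by (simp only: apart_def measure_empty) simp
  next
    case False
    then have "apart 0 x y = \<P>(\<omega> in M. X 0 \<omega> = x \<and> Y 0 \<omega> = y)"
      unfolding apart_def by (intro arg_cong[where f = "measure M"]) auto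
    also have "\<dots> = \<P>(\<omega> in M. X 0 \<omega> = x) * \<P>(\<omega> in M. Y 0 \<omega> = y)"
      using prob_paths_indep[of 0 "\<lambda>_. x" "\<lambda>_. y"] by simp
    finally show ?thesis
      using False 0 by (simp add: init X_init Y_init power2_eq_square)
  qed
next
  case (Suc t)
  then show ?case
    by (simp only: apart_Suc unmet.simps cong: sum.cong)
qed

section \<open>Tail probabilities and expectation of the meeting time\<close>

lemma prob_apart:
  "\<P>(\<omega> in M. \<forall>s\<le>t. X s \<omega> \<noteq> Y s \<omega>) = (\<Sum>x\<in>S. \<Sum>y\<in>S. apart t x y)"
proof -
  let ?H = "\<lambda>(u, v). \<P>(\<omega> in M. \<forall>s\<le>t. X s \<omega> = u s \<and> Y s \<omega> = v s)"
  let ?end = "\<lambda>(u, v). (u t, v t)"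
  have "\<P>(\<omega> in M. \<forall>s\<le>t. X s \<omega> \<noteq> Y s \<omega>) = (\<Sum>w\<in>paths t. ?H w)"
    using prob_sum_paths[of "\<lambda>_. True" t] by simp
  also have "\<dots> = (\<Sum>z\<in>S \<times> S. \<Sum>w\<in>{w \<in> paths t. ?end w = z}. ?H w)"
    by (rule sum.group[OF finite_paths finite_cartesian_product[OF S S], symmetric]) (auto simp: paths_def)
  also have "\<dots> = (\<Sum>(x, y)\<in>S \<times> S. apart t x y)"
  proof (rule sum.cong[OF refl], clarify)
    fix x y
    show "(\<Sum>w\<in>{w \<in> paths t. ?end w = (x, y)}. ?H w) = apart t x y"
      unfolding apart_eq_sum by (intro sum.cong) auto
  qed
  finally show ?thesis
    by (simp add: sum.cartesian_product)
qed

text \<open>The index set of the infimum depends on \<open>\<omega>\<close>; giving the value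
  \<open>\<infinity>\<close> to the times without a meeting turns it into a countable infimum of
  measurable functions.\<close>

lemma measurable_meeting_time: "meeting_time X Y \<in> measurable M (count_space UNIV)"
proof -
  have "meeting_time X Y = (\<lambda>\<omega>. INF t. if X t \<omega> = Y t \<omega> then enat t else \<infinity>)"
  proof (intro ext antisym)
    fix \<omega>
    let ?f = "\<lambda>t. if X t \<omega> = Y t \<omega> then enat t else \<infinity>"
    show "meeting_time X Y \<omega> \<le> (INF t. ?f t)"
      unfolding meeting_time_def by (rule INF_greatest) (auto intro: INF_lower)
    have "(INF t. ?f t) \<le> enat i" if "X i \<omega> = Y i \<omega>" for i
      by (rule INF_lower2[of i]) (use that in simp_all)
    then show "(INF t. ?f t) \<le> meeting_time X Y \<omega>"
      unfolding meeting_time_def by (intro INF_greatest) simp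
  qed
  moreover have "(\<lambda>\<omega>. INF t. if X t \<omega> = Y t \<omega> then enat t else \<infinity>) \<in> measurable M (count_space UNIV)"
    by (intro measurable_INF measurable_If sets_walks_meet) auto
  ultimately show ?thesis
    by simp
qed

text \<open>Continuity from above: the events decrease to the event that the walkers never meet,
  which is null.\<close>

lemma prob_apart_tendsto_0:
  assumes "AE \<omega> in M. meeting_time X Y \<omega> < \<infinity>"
  shows "(\<lambda>t. \<P>(\<omega> in M. \<forall>s\<le>t. X s \<omega> \<noteq> Y s \<omega>)) \<longlonglongrightarrow> 0"
proof -
  let ?A = "\<lambda>t. {\<omega> \<in> space M. \<forall>s\<le>t. X s \<omega> \<noteq> Y s \<omega>}"
  have "(\<lambda>t. prob (?A t)) \<longlonglongrightarrow> prob (\<Inter>t. ?A t)"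
    by (rule finite_Lim_measure_decseq) (auto simp: decseq_def sets_apart)
  also have "prob (\<Inter>t. ?A t) = 0"
  proof -
    have "AE \<omega> in M. \<omega> \<notin> (\<Inter>t. ?A t)"
      using assms
    proof eventually_elim
      case (elim \<omega>)
      then obtain t where "meeting_time X Y \<omega> = enat t"
        by (auto simp: less_infinityE)
      then show ?case
        using less_meeting_time_iff[of t X Y \<omega>] by auto
    qed
    then show ?thesis
      by (subst prob_eq_0) (auto intro!: sets.countable_INT sets_apart)
  qed
  finally show ?thesis .
qed

text \<open>The tail-sum formula: the expectation of \<tau> is the sum over \<open>t\<close> of the
  probabilities that \<tau> exceeds \<open>t\<close>.\<close>

lemma nn_integral_meeting_time:
  "(\<integral>\<^sup>+ \<omega>. ennreal_of_enat (meeting_time X Y \<omega>) \<partial>M)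
    = (\<Sum>t. ennreal (\<P>(\<omega> in M. \<forall>s\<le>t. X s \<omega> \<noteq> Y s \<omega>)))"
  using nn_integral_enat_function[OF measurable_meeting_time]
  by (simp add: less_meeting_time_iff emeasure_eq_measure)

end

theorem theorem2:
  fixes N :: nat and p :: "nat \<Rightarrow> real" and lam :: "nat \<Rightarrow> real"
    and M :: "'w measure" and X Y :: "nat \<Rightarrow> 'w \<Rightarrow> int \<times> int"
  assumes N: "N \<ge> 1"
    and p_nonneg: "\<And>i. i \<le> 4 \<Longrightarrow> p i \<ge> 0"
    and p_sum: "p 0 + p 1 + p 2 + p 3 + p 4 = 1"
    and eigenvalues: "char_poly (meeting_laplacian N p) = (\<Prod>i<N\<^sup>2. [:- lam i, 1:])"
    and M: "prob_space M"
    and X: "markov_chain M (torus N) (torus_step N p) X"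
    and Y: "markov_chain M (torus N) (torus_step N p) Y"
    and X_init: "distr M (count_space (torus N)) (X 0) = uniform_count_measure (torus N)"
    and Y_init: "distr M (count_space (torus N)) (Y 0) = uniform_count_measure (torus N)"
    and indep: "prob_space.indep_var M
        (\<Pi>\<^sub>M t\<in>UNIV. count_space (torus N)) (\<lambda>\<omega> t. X t \<omega>)
        (\<Pi>\<^sub>M t\<in>UNIV. count_space (torus N)) (\<lambda>\<omega> t. Y t \<omega>)"
    and meet: "AE \<omega> in M. meeting_time X Y \<omega> < \<infinity>"
  shows "(\<integral>\<^sup>+ \<omega>. ennreal_of_enat (meeting_time X Y \<omega>) \<partial>M)
       = ennreal (\<Sum>i | i < N\<^sup>2 \<and> lam i \<noteq> 0. inverse (lam i))"
proof -
  let ?S = "torus N" and ?K = "torus_step N p"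
  interpret independent_walks M ?S ?K X Y
    using M X Y indep by (intro independent_walks.intro independent_walks_axioms.intro finite_torus)
  have apart: "\<P>(\<omega> in M. \<forall>s\<le>t. X s \<omega> \<noteq> Y s \<omega>) = (\<Sum>x\<in>?S. \<Sum>y\<in>?S. unmet ?S ?K t x y)" for t
    unfolding prob_apart by (intro sum.cong refl apart_eq_unmet X_init Y_init)
  \<comment> \<open>Almost sure meeting drives the total unmet mass to 0, and the contraction
    argument upgrades this to summability.\<close>
  have summable: "summable (\<lambda>t. unmet ?S ?K t x y)" if "x \<in> ?S" "y \<in> ?S" for x y
    using prob_apart_tendsto_0[OF meet] that
    by (intro summable_unmet finite_torus torus_step_nonneg p_nonneg) (simp_all add: apart)
  have "(\<lambda>t. \<P>(\<omega> in M. \<forall>s\<le>t. X s \<omega> \<noteq> Y s \<omega>)) sums (\<Sum>x\<in>?S. \<Sum>y\<in>?S. green ?S ?K x y)"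
    unfolding apart by (rule sums_green[OF summable])
  then have "(\<Sum>t. ennreal (\<P>(\<omega> in M. \<forall>s\<le>t. X s \<omega> \<noteq> Y s \<omega>)))
      = ennreal (\<Sum>x\<in>?S. \<Sum>y\<in>?S. green ?S ?K x y)"
    by (intro suminf_ennreal_eq measure_nonneg)
  then show ?thesis
    using sum_green_torus[OF N p_sum eigenvalues summable] by (simp add: nn_integral_meeting_time)
qed

end
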